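(* A manifold $M$ is $\omega$-bounded if and only if each end of $M$ is long. In this case, moreover, the end space $\mathcal E(M)$ is finite.
   Context: A manifold is a connected Hausdorff space $M$ for which there is an integer $n\ge 1$ such that every point has an open neighborhood homeomorphic to $\mathbb R^n$; second countability is NOT assumed. A topological space is $\omega$-bounded if every countable subset has compact closure. Freudenthal compactification. Let $X$ be a locally compact Hausdorff space without isolated points. A subset of $X$ is bounded if it is contained in a compact subset of $X$, and unbounded otherwise; for $U$ open, $\partial(U)=\mathrm{cl}_X(U)\setminus U$. Let $\mathscr K(X)$ be the set of finite pairwise-disjoint collections $\mathscr U=\{U_0,\dots,U_n\}$ of open subsets of $X$, with a distinguished element $U_0$, such that $U_0$ is bounded, every $\partial(U_i)$ is compact, and $X=U_0\cup\bigcup_{i=1}^n\mathrm{cl}_X(U_i)$ with this union disjoint. Put $P_{\mathscr U}=\{\{x\}\mid x\in U_0\}\cup\{\mathrm{cl}_X(U_i)\mid 1\le i\le n\}$, a partition of $X$, and order $\mathscr K(X)$ by $\mathscr U\le\mathscr V$ iff $P_{\mathscr V}$ refines $P_{\mathscr U}$; this is a directed set. Let $X_{\mathscr U}$ be the quotient space of $X$ by $P_{\mathscr U}$ (compact Hausdorff), with the natural maps $X_{\mathscr V}\to X_{\mathscr U}$ for $\mathscr U\le\mathscr V$. The Freudenthal compactification $\mathcal F(X)$ is the inverse limit of this system; it is a compact Hausdorff space containing $X$ as a dense open subspace. The space of ends is $\mathcal E(X)=\mathcal F(X)\setminus X$; its points are the ends of $X$. An end $e$ of $X$ is long if it is a weak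 $P$-point of $\mathcal F(X)$, i.e. $e$ is not an accumulation point of any countable subset of $\mathcal F(X)$. *)

theory Defs
  imports "HOL-Analysis.Analysis" "HOL-Library.Disjoint_Sets"
begin

section \<open>Manifolds and omega-bounded spaces\<close>

text \<open>No second countability is assumed.\<close>

definition top_manifold :: "'a topology \<Rightarrow> bool" where
  "top_manifold X \<longleftrightarrow>
     connected_space X \<and> Hausdorff_space X \<and>
     (\<exists>n\<ge>1. \<forall>x \<in> topspace X. \<exists>U. openin X U \<and> x \<in> U \<and>
        subtopology X U homeomorphic_space Euclidean_space n)"

definition omega_bounded :: "'a topology \<Rightarrow> bool" where
  "omega_bounded X \<longleftrightarrow>
     (\<forall>C. C \<subseteq> topspace X \<and> countable C \<longrightarrow> compactin X (X closure_of C))"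


section \<open>The Freudenthal compactification\<close>

text \<open>The construction below is intended for locally compact Hausdorff spaces without
  isolated points.\<close>

definition bounded_in :: "'a topology \<Rightarrow> 'a set \<Rightarrow> bool" where
  "bounded_in X S \<longleftrightarrow> (\<exists>K. compactin X K \<and> S \<subseteq> K)"

text \<open>A collection \<open>{U\<^sub>0, U\<^sub>1, \<dots>, U\<^sub>n}\<close> with distinguished element \<open>U\<^sub>0\<close> is encoded as the
  pair \<open>(U\<^sub>0, {U\<^sub>1, \<dots>, U\<^sub>n})\<close>. The members \<open>U\<^sub>1, \<dots>, U\<^sub>n\<close> are required to be nonempty, so that
  the cells form a partition; \<open>U\<^sub>0\<close> may be empty, and \<open>n\<close> may be \<open>0\<close>.\<close>

definition end_collections :: "'a topology \<Rightarrow> ('a set \<times> 'a set set) set" where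
  "end_collections X =
     {(U0, \<U>).
        finite \<U> \<and> {} \<notin> \<U> \<and>
        disjoint (insert U0 \<U>) \<and>
        (\<forall>U \<in> insert U0 \<U>. openin X U \<and> compactin X (X closure_of U - U)) \<and>
        bounded_in X U0 \<and>
        topspace X = U0 \<union> (\<Union>U\<in>\<U>. X closure_of U) \<and>
        (\<forall>U\<in>\<U>. disjnt U0 (X closure_of U)) \<and>
        disjoint_family_on (\<lambda>U. X closure_of U) \<U>}"

definition cells :: "'a topology \<Rightarrow> 'a set \<times> 'a set set \<Rightarrow> 'a set set" where
  "cells X k = (\<lambda>x. {x}) ` fst k \<union> (\<lambda>U. X closure_of U) ` snd k"

lemma partition_on_cells:
  assumes "k \<in> end_collections X"
  shows "partition_on (topspace X) (cells X k)"
proof -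
  obtain U0 \<U> where k: "k = (U0, \<U>)" by (cases k)
  have ne: "{} \<notin> \<U>"
    and op: "\<And>U. U \<in> \<U> \<Longrightarrow> openin X U"
    and un: "topspace X = U0 \<union> (\<Union>U\<in>\<U>. X closure_of U)"
    and d0: "\<And>U. U \<in> \<U> \<Longrightarrow> disjnt U0 (X closure_of U)"
    and d: "disjoint_family_on (\<lambda>U. X closure_of U) \<U>"
    using assms unfolding end_collections_def k mem_Collect_eq case_prod_conv by blast+
  have "{} \<notin> cells X k"
  proof
    assume "{} \<in> cells X k"
    then obtain U where U: "U \<in> \<U>" "X closure_of U = {}"
      by (auto simp: cells_def k)
    then have "U = {}"
      using closure_of_subset[OF openin_subset[OF op[OF U(1)]]] by simp
    then show False using ne U(1) by simp
  qed
  moreover have "\<Union> (cells X k) = topspace X"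
    by (subst un) (simp add: cells_def k)
  moreover have "disjoint (cells X k)"
  proof (rule disjointI)
    fix c c' assume c: "c \<in> cells X k" "c' \<in> cells X k" "c \<noteq> c'"
    have dd: "X closure_of U \<inter> X closure_of V = {}"
      if "U \<in> \<U>" "V \<in> \<U>" "X closure_of U \<noteq> X closure_of V" for U V
    proof -
      have "U \<noteq> V" using that(3) by blast
      with d that(1,2) show ?thesis unfolding disjoint_family_on_def by blast
    qed
    have sing: "{x} \<inter> X closure_of U = {}" if "x \<in> U0" "U \<in> \<U>" for x U
      using d0[OF that(2)] that(1) by (auto simp: disjnt_def)
    have cc: "(\<exists>x\<in>U0. e = {x}) \<or> (\<exists>U\<in>\<U>. e = X closure_of U)" if "e \<in> cells X k" for e
      using that unfolding cells_def k by auto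
    show "c \<inter> c' = {}"
      using cc[OF c(1)] cc[OF c(2)]
    proof (elim disjE bexE)
      fix x y assume "c = {x}" "c' = {y}"
      then show ?thesis using c(3) by blast
    next
      fix x U assume "x \<in> U0" "U \<in> \<U>" "c = {x}" "c' = X closure_of U"
      then show ?thesis using sing by blast
    next
      fix x U assume "x \<in> U0" "U \<in> \<U>" "c = X closure_of U" "c' = {x}"
      then show ?thesis using sing by blast
    next
      fix U V assume UV: "U \<in> \<U>" "V \<in> \<U>" "c = X closure_of U" "c' = X closure_of V"
      then show ?thesis using dd[OF UV(1,2)] c(3) by simp
    qed
  qed
  ultimately show ?thesis by (simp add: partition_on_def)
qed

text \<open>\<open>end_le X k l\<close> is the order \<open>k \<le> l\<close>: the partition of the larger index is the finer one.\<close>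

definition end_le :: "'a topology \<Rightarrow> 'a set \<times> 'a set set \<Rightarrow> 'a set \<times> 'a set set \<Rightarrow> bool" where
  "end_le X k l \<longleftrightarrow> refines (topspace X) (cells X l) (cells X k)"

text \<open>The quotient space of \<open>X\<close> by a partition \<open>P\<close>, with the members of \<open>P\<close> as its points.\<close>

definition partition_topology :: "'a topology \<Rightarrow> 'a set set \<Rightarrow> 'a set topology" where
  "partition_topology X P = topology (\<lambda>\<V>. \<V> \<subseteq> P \<and> openin X (\<Union>\<V>))"

lemma openin_partition_topology:
  assumes "partition_on (topspace X) P"
  shows "openin (partition_topology X P) \<V> \<longleftrightarrow> \<V> \<subseteq> P \<and> openin X (\<Union>\<V>)"
proof -
  have int: "\<Union>(\<A> \<inter> \<B>) = \<Union>\<A> \<inter> \<Union>\<B>" if "\<A> \<subseteq> P" "\<B> \<subseteq> P" for \<A> \<B>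
  proof
    show "\<Union>\<A> \<inter> \<Union>\<B> \<subseteq> \<Union>(\<A> \<inter> \<B>)"
    proof
      fix x assume "x \<in> \<Union>\<A> \<inter> \<Union>\<B>"
      then obtain a b where ab: "a \<in> \<A>" "b \<in> \<B>" "x \<in> a" "x \<in> b" by blast
      then have "a = b"
        using disjointD[OF partition_onD2[OF assms], of a b] that by blast
      then show "x \<in> \<Union>(\<A> \<inter> \<B>)" using ab by blast
    qed
  qed blast
  have "istopology (\<lambda>\<V>. \<V> \<subseteq> P \<and> openin X (\<Union>\<V>))"
    unfolding istopology_def
  proof (intro conjI allI impI)
    fix \<A> \<B> assume AB: "\<A> \<subseteq> P \<and> openin X (\<Union>\<A>)" "\<B> \<subseteq> P \<and> openin X (\<Union>\<B>)"
    then show "\<A> \<inter> \<B> \<subseteq> P" by blast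
    have "\<Union>(\<A> \<inter> \<B>) = \<Union>\<A> \<inter> \<Union>\<B>" by (rule int) (use AB in blast)+
    then show "openin X (\<Union>(\<A> \<inter> \<B>))" using AB by (metis openin_Int)
  next
    fix \<K> assume K: "\<forall>\<V>\<in>\<K>. \<V> \<subseteq> P \<and> openin X (\<Union>\<V>)"
    then show "\<Union>\<K> \<subseteq> P" by blast
    have "\<Union>(\<Union>\<K>) = (\<Union>\<V>\<in>\<K>. \<Union>\<V>)" by blast
    moreover have "openin X (\<Union>\<V>\<in>\<K>. \<Union>\<V>)"
      by (rule openin_Union) (use K in blast)
    ultimately show "openin X (\<Union>(\<Union>\<K>))" by (simp only:)
  qed
  then show ?thesis by (simp add: partition_topology_def topology_inverse')
qed

lemma topspace_partition_topology:
  assumes "partition_on (topspace X) P"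
  shows "topspace (partition_topology X P) = P"
proof
  show "topspace (partition_topology X P) \<subseteq> P"
    using openin_partition_topology[OF assms] openin_topspace by blast
  have "openin (partition_topology X P) P"
    unfolding openin_partition_topology[OF assms] using partition_onD1[OF assms, symmetric] by simp
  then show "P \<subseteq> topspace (partition_topology X P)" by (rule openin_subset)
qed

definition cell_of :: "'a set set \<Rightarrow> 'a \<Rightarrow> 'a set" where
  "cell_of P x = (THE c. c \<in> P \<and> x \<in> c)"

lemma cell_of_eq:
  assumes P: "partition_on A P" and c: "c \<in> P" "x \<in> c"
  shows "cell_of P x = c"
  unfolding cell_of_def
proof (rule the_equality)
  fix d assume "d \<in> P \<and> x \<in> d"
  then show "d = c"
    using c disjointD[OF partition_onD2[OF P], of d c] by blast
qed (use c in blast)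

lemma quotient_map_cell_of:
  assumes "partition_on (topspace X) P"
  shows "quotient_map X (partition_topology X P) (cell_of P)"
proof -
  note cell = cell_of_eq[OF assms]
  have top: "topspace X = \<Union>P" and ne: "{} \<notin> P"
    using assms by (auto simp: partition_on_def)
  have img: "cell_of P ` topspace X = P"
  proof
    show "cell_of P ` topspace X \<subseteq> P"
      unfolding top using cell by blast
    show "P \<subseteq> cell_of P ` topspace X"
    proof
      fix c assume c: "c \<in> P"
      then obtain x where x: "x \<in> c" using ne by (metis equals0I)
      then have "x \<in> topspace X" using c top by blast
      then show "c \<in> cell_of P ` topspace X" using cell[OF c x] by blast
    qed
  qed
  have pre: "{x \<in> topspace X. cell_of P x \<in> \<V>} = \<Union>\<V>" if V: "\<V> \<subseteq> P" for \<V>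
  proof (intro set_eqI iffI)
    fix x assume "x \<in> {x \<in> topspace X. cell_of P x \<in> \<V>}"
    then obtain c where "c \<in> P" "x \<in> c" "cell_of P x \<in> \<V>" using top by blast
    then show "x \<in> \<Union>\<V>" using cell by auto
  next
    fix x assume "x \<in> \<Union>\<V>"
    then obtain c where c: "c \<in> \<V>" "x \<in> c" by blast
    then have "c \<in> P" using V by blast
    then show "x \<in> {x \<in> topspace X. cell_of P x \<in> \<V>}"
      using c cell[of c x] top by auto
  qed
  show ?thesis
    unfolding quotient_map_def topspace_partition_topology[OF assms] img
    by (simp add: pre openin_partition_topology[OF assms])
qed

text \<open>For \<open>k \<le> l\<close>, the natural map from the quotient by \<open>cells X l\<close> to the quotient by
  \<open>cells X k\<close> sends a cell to the unique cell containing it.\<close>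

definition bonding_map :: "'a topology \<Rightarrow> 'a set \<times> 'a set set \<Rightarrow> 'a set \<Rightarrow> 'a set" where
  "bonding_map X k c = (THE d. d \<in> cells X k \<and> c \<subseteq> d)"

lemma bonding_map_cell_of:
  assumes "end_le X k l" "x \<in> topspace X"
  shows "bonding_map X k (cell_of (cells X l) x) = cell_of (cells X k) x"
proof -
  have P: "partition_on (topspace X) (cells X l)" "partition_on (topspace X) (cells X k)"
    and r: "\<And>c. c \<in> cells X l \<Longrightarrow> \<exists>d\<in>cells X k. c \<subseteq> d"
    using assms(1) unfolding end_le_def refines_def by blast+
  obtain c where c: "c \<in> cells X l" "x \<in> c"
    using partition_onD1[OF P(1)] assms(2) by blast
  obtain d where d: "d \<in> cells X k" "c \<subseteq> d" using r[OF c(1)] by blast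
  have uniq: "d' = d" if "d' \<in> cells X k" "x \<in> d'" for d'
    using cell_of_eq[OF P(2) that] cell_of_eq[OF P(2) d(1)] d c by (metis subsetD)
  have "cell_of (cells X l) x = c"
    by (rule cell_of_eq[OF P(1) c])
  moreover have "cell_of (cells X k) x = d"
    using cell_of_eq[OF P(2) d(1)] d c by blast
  moreover have "bonding_map X k c = d"
    unfolding bonding_map_def
    by (rule the_equality) (use uniq d c in blast)+
  ultimately show ?thesis by simp
qed

definition Freudenthal :: "'a topology \<Rightarrow> ('a set \<times> 'a set set \<Rightarrow> 'a set) topology" where
  "Freudenthal X =
     subtopology
       (product_topology (\<lambda>k. partition_topology X (cells X k)) (end_collections X))
       {t. \<forall>k \<in> end_collections X. \<forall>l \<in> end_collections X.
             end_le X k l \<longrightarrow> bonding_map X k (t l) = t k}"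

text \<open>The canonical copy of \<open>X\<close> in its Freudenthal compactification.\<close>

definition Freudenthal_embed :: "'a topology \<Rightarrow> 'a \<Rightarrow> ('a set \<times> 'a set set \<Rightarrow> 'a set)" where
  "Freudenthal_embed X x = (\<lambda>k \<in> end_collections X. cell_of (cells X k) x)"

lemma continuous_map_Freudenthal_embed:
  "continuous_map X (Freudenthal X) (Freudenthal_embed X)"
proof -
  have "continuous_map X (partition_topology X (cells X k)) (\<lambda>x. Freudenthal_embed X x k)"
    if "k \<in> end_collections X" for k
    using quotient_imp_continuous_map[OF quotient_map_cell_of[OF partition_on_cells[OF that]]] that
    by (simp add: Freudenthal_embed_def)
  then show ?thesis
    unfolding Freudenthal_def
    by (auto simp: continuous_map_in_subtopology continuous_map_componentwise
        Freudenthal_embed_def bonding_map_cell_of)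
qed


section \<open>Ends\<close>

definition ends :: "'a topology \<Rightarrow> ('a set \<times> 'a set set \<Rightarrow> 'a set) set" where
  "ends X = topspace (Freudenthal X) - Freudenthal_embed X ` topspace X"

definition weak_P_point :: "'a topology \<Rightarrow> 'a \<Rightarrow> bool" where
  "weak_P_point Z p \<longleftrightarrow>
     p \<in> topspace Z \<and> (\<forall>C. C \<subseteq> topspace Z \<and> countable C \<longrightarrow> p \<notin> Z derived_set_of C)"

definition long_end :: "'a topology \<Rightarrow> ('a set \<times> 'a set set \<Rightarrow> 'a set) \<Rightarrow> bool" where
  "long_end X e \<longleftrightarrow> e \<in> ends X \<and> weak_P_point (Freudenthal X) e"

end

theory Submission
  imports Defs
begin

text \<open>An end is a coherent choice of a cell \<open>cl U\<close> from every collection in \<open>\<K>(X)\<close>.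

  If \<open>C\<close> is countable and not contained in a compact set, an ultrafilter containing \<open>C - K\<close> for
  every compact \<open>K\<close> picks exactly one of the finitely many unbounded cells of each collection;
  these choices form an end at which \<open>C\<close> accumulates, so that end is not long.

  Conversely, let \<open>M\<close> be \<open>\<omega>\<close>-bounded and suppose that it has infinitely many ends. For
  each \<open>N\<close> choose a collection separating \<open>N\<close> ends. The boundaries of all these collections
  lie in the closure of one countable set, hence in a compact \<open>K\<close>. Enclose \<open>K\<close> in an open
  bounded \<open>G\<close> with compact boundary and cover \<open>cl G - G\<close> by finitely many, say \<open>r\<close>, connected
  open sets that miss \<open>K\<close>. Each of the \<open>N\<close> members \<open>U\<close> belonging to the chosen ends meets
  \<open>cl G - G\<close> because \<open>M\<close> is connected, and so contains one of the \<open>r\<close> connected sets, which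
  cannot cross the boundary of \<open>U\<close>. Hence \<open>N \<le> r\<close> for every \<open>N\<close>, a contradiction. With
  finitely many ends, a countable subset of \<open>\<F>(M)\<close> consists of finitely many ends and a subset
  of \<open>M\<close> with compact closure, and accumulates at no end.\<close>

section \<open>Refinement of collections\<close>

lemma end_collectionsD:
  assumes "k \<in> end_collections X"
  shows "finite (snd k)" "{} \<notin> snd k" "bounded_in X (fst k)" "openin X (fst k)"
    "topspace X = fst k \<union> (\<Union>U\<in>snd k. X closure_of U)"
    "\<And>U. U \<in> snd k \<Longrightarrow> openin X U"
    "\<And>U. U \<in> snd k \<Longrightarrow> compactin X (X closure_of U - U)"
    "\<And>U. U \<in> snd k \<Longrightarrow> fst k \<inter> X closure_of U = {}"
    "\<And>U V. U \<in> snd k \<Longrightarrow> V \<in> snd k \<Longrightarrow> U \<noteq> V \<Longrightarrow> X closure_of U \<inter> X closure_of V = {}"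
  using assms unfolding end_collections_def
  by (auto simp: disjnt_def disjoint_family_on_def) (metis disjoint_iff)+

lemma compactin_boundary:
  assumes "openin X U" "compactin X K" "X closure_of U - U \<subseteq> K"
  shows "compactin X (X closure_of U - U)"
  using closed_compactin[OF assms(2,3)] assms(1) by (simp add: closedin_diff)

text \<open>Local compactness gives \<open>K \<subseteq> V \<subseteq> L\<close> with
  \<open>V\<close> open and \<open>L\<close> compact and closed. The outside of \<open>L\<close>
  supplies the only remaining cell, and \<open>U0\<close>, the complement of its closure, still
  contains \<open>V\<close>. So every compact set can be split into singleton cells, away from all
  ends.\<close>

lemma compact_subset_end_collection:
  assumes X: "locally_compact_space X" "Hausdorff_space X" and K: "compactin X K"
  obtains k where "k \<in> end_collections X" "K \<subseteq> fst k" "compactin X (X closure_of (fst k))"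
    "compactin X (X closure_of (fst k) - fst k)"
proof -
  obtain V L where V: "openin X V" "compactin X L" "closedin X L" "K \<subseteq> V" "V \<subseteq> L"
    using X K locally_compact_space_compact_closed_compact by metis
  define U1 where "U1 = topspace X - L"
  define U0 where "U0 = topspace X - X closure_of U1"
  have op: "openin X U1" "openin X U0"
    using V by (auto simp: U1_def U0_def openin_diff)
  have "V \<inter> X closure_of U1 = {}"
    using V by (subst openin_Int_closure_of_eq_empty) (auto simp: U1_def)
  then have KU0: "K \<subseteq> U0"
    using V openin_subset[OF V(1)] by (auto simp: U0_def)
  have U1sub: "U1 \<subseteq> X closure_of U1"
    by (simp add: closure_of_subset op(1) openin_subset)
  then have U0L: "U0 \<subseteq> L" by (auto simp: U0_def U1_def)
  have clU0: "X closure_of U0 \<subseteq> L"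
    using U0L V(3) by (simp add: closure_of_minimal)
  have clU1: "X closure_of U1 - U1 \<subseteq> L"
    using closure_of_subset_topspace[of X U1] by (auto simp: U1_def)
  have b: "compactin X (X closure_of U0 - U0)" "compactin X (X closure_of U1 - U1)"
    using compactin_boundary[OF op(2) V(2)] compactin_boundary[OF op(1) V(2) clU1] clU0 by auto
  \<comment> \<open>Members must be nonempty, so \<open>U1\<close> is dropped when \<open>L\<close>
    is the whole space.\<close>
  have "(U0, {U1} - {{}}) \<in> end_collections X"
    unfolding end_collections_def
    using op b V(2) U0L U1sub closure_of_subset_topspace[of X U1]
    by (cases "U1 = {}")
       (auto simp: U0_def bounded_in_def disjnt_def disjoint_family_on_def disjoint_def)
  moreover have "compactin X (X closure_of U0)"
    using closed_compactin[OF V(2) clU0] by simp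
  ultimately show ?thesis using that[of "(U0, {U1} - {{}})"] KU0 b by auto
qed

text \<open>Directedness of the index set, obtained from pairwise intersections of members. It is
  what allows two coordinates of a thread to be compared.\<close>

lemma end_collections_common_refinement:
  assumes k: "k \<in> end_collections X" and l: "l \<in> end_collections X"
  obtains m where "m \<in> end_collections X" "end_le X k m" "end_le X l m"
proof -
  note K = end_collectionsD[OF k] and L = end_collectionsD[OF l]
  \<comment> \<open>The cells are \<open>cl (U \<inter> V)\<close>, which may be smaller than \<open>cl U \<inter> cl V\<close>; the difference is
    absorbed by \<open>W0\<close>.\<close>
  define \<W> where "\<W> = (\<lambda>(U, V). U \<inter> V) ` (snd k \<times> snd l) - {{}}"
  define W0 where "W0 = topspace X - (\<Union>W\<in>\<W>. X closure_of W)"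
  have fin: "finite \<W>" using K(1) L(1) by (simp add: \<W>_def)
  have W: "\<exists>U\<in>snd k. \<exists>V\<in>snd l. W = U \<inter> V" if "W \<in> \<W>" for W
    using that by (auto simp: \<W>_def)
  have Wop: "openin X W" if "W \<in> \<W>" for W
    using W[OF that] K(6) L(6) by auto
  have Wcl: "W \<subseteq> X closure_of W" if "W \<in> \<W>" for W
    by (simp add: Wop closure_of_subset openin_subset that)
  have Wbd: "compactin X (X closure_of W - W)" if "W \<in> \<W>" for W
  proof -
    obtain U V where UV: "U \<in> snd k" "V \<in> snd l" "W = U \<inter> V" using W[OF \<open>W \<in> \<W>\<close>] by blast
    have "X closure_of W \<subseteq> X closure_of U" "X closure_of W \<subseteq> X closure_of V"
      by (simp_all add: UV(3) closure_of_mono)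
    then show ?thesis
      using UV compactin_boundary[OF Wop[OF that] compactin_Un[OF K(7)[OF UV(1)] L(7)[OF UV(2)]]]
      by blast
  qed
  have Wdisj: "X closure_of W \<inter> X closure_of W' = {}" if WW: "W \<in> \<W>" "W' \<in> \<W>" "W \<noteq> W'" for W W'
  proof -
    obtain U V U' V' where *: "U \<in> snd k" "V \<in> snd l" "W = U \<inter> V"
        "U' \<in> snd k" "V' \<in> snd l" "W' = U' \<inter> V'"
      using W[OF WW(1)] W[OF WW(2)] by blast
    then have "U \<noteq> U' \<or> V \<noteq> V'" using WW by blast
    moreover have "X closure_of W \<subseteq> X closure_of U" "X closure_of W \<subseteq> X closure_of V"
      "X closure_of W' \<subseteq> X closure_of U'" "X closure_of W' \<subseteq> X closure_of V'"
      by (simp_all add: *(3,6) closure_of_mono)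
    ultimately show ?thesis
      using * K(9)[of U U'] L(9)[of V V'] by blast
  qed
  have W0op: "openin X W0"
    unfolding W0_def using fin by (intro openin_diff closedin_Union) auto
  have W0W: "X closure_of W0 \<inter> W = {}" if "W \<in> \<W>" for W
    using openin_Int_closure_of_eq_empty[OF Wop[OF that], of W0] Wcl[OF that] that
    by (auto simp: W0_def)
  \<comment> \<open>A point of the closure outside \<open>W0\<close> lies in some
    \<open>X closure_of W\<close>; it cannot lie in the open set \<open>W\<close>, which misses
    \<open>W0\<close>.\<close>
  have "X closure_of W0 - W0 \<subseteq> (\<Union>W\<in>\<W>. X closure_of W - W)"
    using W0W closure_of_subset_topspace[of X W0] by (auto simp: W0_def)
  then have W0bd: "compactin X (X closure_of W0 - W0)"
    using fin Wbd by (intro compactin_boundary[OF W0op, of "\<Union>W\<in>\<W>. X closure_of W - W"])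
      (auto intro!: compactin_Union)
  obtain P Q where PQ: "compactin X P" "fst k \<subseteq> P" "compactin X Q" "fst l \<subseteq> Q"
    using K(3) L(3) by (auto simp: bounded_in_def)
  \<comment> \<open>A compact bound for \<open>W0\<close>: a point outside \<open>B\<close> avoids
    both bounded parts and all boundaries, so it lies in some \<open>U \<inter> V\<close>, which
    belongs to \<open>\<W>\<close> and is disjoint from \<open>W0\<close>.\<close>
  define B where "B = (P \<union> Q) \<union> ((\<Union>U\<in>snd k. X closure_of U - U) \<union> (\<Union>V\<in>snd l. X closure_of V - V))"
  have "compactin X B"
    unfolding B_def using PQ K(1,7) L(1,7) by (intro compactin_Un compactin_Union) auto
  moreover have "W0 \<subseteq> B"
  proof
    fix x assume x: "x \<in> W0"
    show "x \<in> B"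
    proof (rule ccontr)
      assume nB: "x \<notin> B"
      have xX: "x \<in> topspace X" using x by (auto simp: W0_def)
      have "x \<notin> fst k" "x \<notin> fst l"
        using nB PQ by (auto simp: B_def)
      with xX obtain U V where UV: "U \<in> snd k" "x \<in> X closure_of U" "V \<in> snd l" "x \<in> X closure_of V"
        using K(5) L(5) by (metis UN_E UnE)
      moreover have "x \<in> U" "x \<in> V"
        using nB UV by (auto simp: B_def)
      ultimately have UV: "U \<in> snd k" "x \<in> U" "V \<in> snd l" "x \<in> V" by auto
      then have "U \<inter> V \<in> \<W>" by (auto simp: \<W>_def)
      then have "x \<notin> W0" using Wcl UV by (auto simp: W0_def)
      then show False using x by blast
    qed
  qed
  ultimately have W0bounded: "bounded_in X W0" by (auto simp: bounded_in_def)
  have "(\<Union>W\<in>\<W>. X closure_of W) \<subseteq> topspace X"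
    by (intro UN_least closure_of_subset_topspace)
  then have top: "topspace X = W0 \<union> (\<Union>W\<in>\<W>. X closure_of W)"
    unfolding W0_def by blast
  have "W0 \<inter> W = {}" if "W \<in> \<W>" for W
    using Wcl[OF that] that by (auto simp: W0_def)
  moreover have "W \<inter> W' = {}" if "W \<in> \<W>" "W' \<in> \<W>" "W \<noteq> W'" for W W'
    using Wdisj[OF that] Wcl[OF that(1)] Wcl[OF that(2)] by blast
  ultimately have "disjoint (insert W0 \<W>)"
    by (auto simp: disjoint_def disjnt_def)
  moreover have "\<forall>U\<in>\<W>. disjnt W0 (X closure_of U)" by (auto simp: W0_def disjnt_def)
  moreover have "{} \<notin> \<W>" by (simp add: \<W>_def)
  ultimately have m: "(W0, \<W>) \<in> end_collections X"
    unfolding end_collections_def disjoint_family_on_def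
    using fin Wop W0op Wbd W0bd W0bounded top Wdisj by simp
  \<comment> \<open>Stated for a generic \<open>j\<close>, to be applied to both \<open>k\<close>
    and \<open>l\<close>.\<close>
  have ref: "end_le X j (W0, \<W>)"
    if j: "j \<in> end_collections X" and sub: "\<And>W. W \<in> \<W> \<Longrightarrow> \<exists>U\<in>snd j. W \<subseteq> U" for j
  proof -
    note P = partition_on_cells[OF j]
    have "\<exists>d\<in>cells X j. c \<subseteq> d" if c: "c \<in> cells X (W0, \<W>)" for c
    proof -
      consider x where "c = {x}" "x \<in> W0" | W where "W \<in> \<W>" "c = X closure_of W"
        using c by (auto simp: cells_def)
      then show ?thesis
      proof cases
        case 1
        then have "x \<in> \<Union>(cells X j)"
          using partition_onD1[OF P] by (auto simp: W0_def)
        then show ?thesis using 1 by auto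
      next
        case 2
        then obtain U where "U \<in> snd j" "W \<subseteq> U" using sub by blast
        then show ?thesis using 2 closure_of_mono[of W U X] by (auto simp: cells_def)
      qed
    qed
    then show ?thesis
      using P partition_on_cells[OF m] by (auto simp: end_le_def refines_def)
  qed
  show ?thesis
    by (rule that[OF m]; rule ref[OF k] ref[OF l]; use W in blast)
qed

lemma end_le_trans: "end_le X k l \<Longrightarrow> end_le X l m \<Longrightarrow> end_le X k m"
  unfolding end_le_def by (rule refines_trans)

lemma end_collections_upper_bound:
  assumes "finite S" "S \<noteq> {}" "S \<subseteq> end_collections X"
  shows "\<exists>m\<in>end_collections X. \<forall>k\<in>S. end_le X k m"
  using assms
proof (induction S rule: finite_ne_induct)
  case (singleton k)
  then show ?case
    using end_collections_common_refinement[of k X k] by blast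
next
  case (insert k S)
  then obtain l where l: "l \<in> end_collections X" "\<forall>j\<in>S. end_le X j l" by auto
  obtain m where m: "m \<in> end_collections X" "end_le X k m" "end_le X l m"
    using end_collections_common_refinement[of k X l] insert.prems l by auto
  with l show ?case by (metis end_le_trans insert_iff)
qed

section \<open>Threads and ends\<close>

text \<open>Replaces the definite description by inclusion, so that threads can be handled as
  choices of cells that shrink along the order.\<close>

lemma bonding_map_eq_iff:
  assumes "end_le X k l" "c \<in> cells X l" "d \<in> cells X k"
  shows "bonding_map X k c = d \<longleftrightarrow> c \<subseteq> d"
proof -
  have P: "partition_on (topspace X) (cells X l)" "partition_on (topspace X) (cells X k)"
    and r: "\<exists>d\<in>cells X k. c \<subseteq> d"
    using assms unfolding end_le_def refines_def by blast+
  have "c \<noteq> {}" using P(1) assms(2) by (auto simp: partition_on_def)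
  then have uniq: "d1 = d2" if "d1 \<in> cells X k" "d2 \<in> cells X k" "c \<subseteq> d1" "c \<subseteq> d2" for d1 d2
    using disjointD[OF partition_onD2[OF P(2)] that(1,2)] that(3,4) by blast
  obtain d' where d': "d' \<in> cells X k" "c \<subseteq> d'" using r by blast
  have "bonding_map X k c = d'"
    unfolding bonding_map_def by (rule the_equality) (use uniq d' in blast)+
  then show ?thesis using d' uniq assms(3) by blast
qed

lemma topspace_Freudenthal:
  "t \<in> topspace (Freudenthal X) \<longleftrightarrow>
     t \<in> (\<Pi>\<^sub>E k\<in>end_collections X. cells X k) \<and>
     (\<forall>k\<in>end_collections X. \<forall>l\<in>end_collections X. end_le X k l \<longrightarrow> t l \<subseteq> t k)"
proof -
  have "topspace (product_topology (\<lambda>k. partition_topology X (cells X k)) (end_collections X))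
      = (\<Pi>\<^sub>E k\<in>end_collections X. cells X k)"
    by (simp add: topspace_partition_topology partition_on_cells cong: PiE_cong)
  moreover have "bonding_map X k (t l) = t k \<longleftrightarrow> t l \<subseteq> t k"
    if "t \<in> (\<Pi>\<^sub>E k\<in>end_collections X. cells X k)" "k \<in> end_collections X" "l \<in> end_collections X"
      "end_le X k l" for k l
    using bonding_map_eq_iff[OF that(4) PiE_mem[OF that(1,3)] PiE_mem[OF that(1,2)]] .
  ultimately show ?thesis
    unfolding Freudenthal_def topspace_subtopology Int_iff mem_Collect_eq by (intro conj_cong ball_cong imp_cong refl) simp_all
qed

lemma Freudenthal_cell:
  assumes "t \<in> topspace (Freudenthal X)" "k \<in> end_collections X"
  shows "t k \<in> cells X k" "t k \<noteq> {}"
proof -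
  show *: "t k \<in> cells X k" using assms by (auto simp: topspace_Freudenthal)
  then show "t k \<noteq> {}" using partition_on_cells[OF assms(2)] by (auto simp: partition_on_def)
qed

lemma Freudenthal_mono:
  assumes "t \<in> topspace (Freudenthal X)" "k \<in> end_collections X" "l \<in> end_collections X" "end_le X k l"
  shows "t l \<subseteq> t k"
  using assms by (auto simp: topspace_Freudenthal)

lemma Freudenthal_eqI:
  assumes "s \<in> topspace (Freudenthal X)" "t \<in> topspace (Freudenthal X)"
    and "\<And>k. k \<in> end_collections X \<Longrightarrow> s k = t k"
  shows "s = t"
  using assms by (intro PiE_ext[of s "end_collections X" "cells X"]) (auto simp: topspace_Freudenthal)

lemma Freudenthal_embed_in_topspace:
  "x \<in> topspace X \<Longrightarrow> Freudenthal_embed X x \<in> topspace (Freudenthal X)"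
  using continuous_map_Freudenthal_embed by (rule continuous_map_image_subset_topspace[THEN subsetD]) simp

lemma Freudenthal_embed_eq:
  assumes "k \<in> end_collections X" "c \<in> cells X k" "x \<in> c"
  shows "Freudenthal_embed X x k = c"
  using cell_of_eq[OF partition_on_cells[OF assms(1)] assms(2,3)] assms(1)
  by (simp add: Freudenthal_embed_def)

text \<open>At a common refinement \<open>m\<close> of \<open>k\<close> and \<open>l\<close>, the
  nonempty cell \<open>t m\<close> lies in \<open>{x}\<close> and in \<open>t l\<close>; hence
  \<open>x\<close> lies in every coordinate.\<close>

lemma Freudenthal_singleton_cell:
  assumes t: "t \<in> topspace (Freudenthal X)" and k: "k \<in> end_collections X" "t k = {x}"
  shows "t = Freudenthal_embed X x"
proof (rule Freudenthal_eqI[OF t Freudenthal_embed_in_topspace])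
  show "x \<in> topspace X"
    using Freudenthal_cell(1)[OF t k(1)] partition_onD1[OF partition_on_cells[OF k(1)]] k(2) by auto
  fix l assume l: "l \<in> end_collections X"
  obtain m where m: "m \<in> end_collections X" "end_le X k m" "end_le X l m"
    using end_collections_common_refinement[OF k(1) l] .
  have "t m \<subseteq> {x}" "t m \<subseteq> t l" "t m \<noteq> {}"
    using Freudenthal_mono[OF t k(1) m(1,2)] Freudenthal_mono[OF t l m(1,3)] Freudenthal_cell[OF t m(1)] k
    by auto
  then have "x \<in> t l" by auto
  then show "t l = Freudenthal_embed X x l"
    using Freudenthal_embed_eq[OF l Freudenthal_cell(1)[OF t l]] by simp
qed

text \<open>A coordinate \<open>{x}\<close> with \<open>x\<close> in the bounded part would turn the
  thread into the embedded point \<open>x\<close>.\<close>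

lemma ends_cell:
  assumes e: "e \<in> ends X" and k: "k \<in> end_collections X"
  shows "\<exists>U\<in>snd k. e k = X closure_of U"
proof -
  have t: "e \<in> topspace (Freudenthal X)" using e by (simp add: ends_def)
  have "e k \<noteq> {x}" if x: "x \<in> fst k" for x
  proof
    assume "e k = {x}"
    then have "e = Freudenthal_embed X x" by (rule Freudenthal_singleton_cell[OF t k])
    moreover have "x \<in> topspace X" using x end_collectionsD(4)[OF k] openin_subset by blast
    ultimately show False using e by (simp add: ends_def)
  qed
  then show ?thesis using Freudenthal_cell(1)[OF t k] by (auto simp: cells_def)
qed

text \<open>If \<open>e l\<close> lay in a compact \<open>K\<close>, choose \<open>k\<close> whose
  bounded part contains \<open>K\<close>. The cell of \<open>e\<close> at a common refinement would
  lie both in \<open>K\<close> and in \<open>e k\<close>, which misses the bounded part.\<close>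

lemma ends_cell_unbounded:
  assumes X: "locally_compact_space X" "Hausdorff_space X"
    and e: "e \<in> ends X" and l: "l \<in> end_collections X"
  shows "\<not> bounded_in X (e l)"
proof
  assume "bounded_in X (e l)"
  then obtain K where K: "compactin X K" "e l \<subseteq> K" by (auto simp: bounded_in_def)
  have t: "e \<in> topspace (Freudenthal X)" using e by (simp add: ends_def)
  obtain k where k: "k \<in> end_collections X" "K \<subseteq> fst k"
    using compact_subset_end_collection[OF X K(1)] by metis
  obtain m where m: "m \<in> end_collections X" "end_le X k m" "end_le X l m"
    using end_collections_common_refinement[OF k(1) l] .
  have "e m \<subseteq> e k" "e m \<subseteq> e l" "e m \<noteq> {}"
    using Freudenthal_mono[OF t k(1) m(1,2)] Freudenthal_mono[OF t l m(1,3)] Freudenthal_cell(2)[OF t m(1)]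
    by auto
  moreover have "e k \<inter> fst k = {}"
    using ends_cell[OF e k(1)] end_collectionsD(8)[OF k(1)] by blast
  ultimately show False using K k by blast
qed

text \<open>Cells are closed, so each quotient is T1, and this passes to products and subspaces. It
  serves to show that finite sets have no accumulation points.\<close>

lemma t1_space_Freudenthal:
  assumes "Hausdorff_space X"
  shows "t1_space (Freudenthal X)"
proof -
  have "t1_space (partition_topology X (cells X k))" if k: "k \<in> end_collections X" for k
    unfolding t1_space_closedin_singleton
  proof
    note P = partition_on_cells[OF k]
    fix c assume "c \<in> topspace (partition_topology X (cells X k))"
    then have c: "c \<in> cells X k" by (simp add: topspace_partition_topology[OF P])
    have "closedin X c"
    proof -
      consider x where "x \<in> fst k" "c = {x}" | U where "c = X closure_of U"
        using c by (auto simp: cells_def)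
      then show ?thesis
      proof cases
        case 1
        then have "x \<in> topspace X" using end_collectionsD(4)[OF k] openin_subset by blast
        then show ?thesis
          using Hausdorff_imp_t1_space[OF assms] 1 by (simp add: t1_space_closedin_singleton)
      qed simp
    qed
    moreover have "\<Union>(cells X k - {c}) = topspace X - c"
    proof -
      have "c \<inter> d = {}" if "d \<in> cells X k" "d \<noteq> c" for d
        using disjointD[OF partition_onD2[OF P] c that(1)] that(2) by auto
      then show ?thesis
        using partition_onD1[OF P] by blast
    qed
    ultimately show "closedin (partition_topology X (cells X k)) {c}"
      using c by (auto simp: closedin_def topspace_partition_topology[OF P] openin_partition_topology[OF P])
  qed
  then show ?thesis
    unfolding Freudenthal_def by (intro t1_space_subtopology) (simp add: t1_space_product_topology)
qed

section \<open>Long ends imply omega-boundedness\<close>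

text \<open>Zorn's lemma for families with the finite intersection property: a finite subfamily of
  the union of a chain already lies in one member of the chain.\<close>

lemma ultrafilter_extension:
  assumes fip: "\<forall>\<F>. finite \<F> \<and> \<F> \<subseteq> \<B> \<longrightarrow> \<Inter>\<F> \<noteq> {}"
  shows "\<exists>\<U>. \<B> \<subseteq> \<U> \<and> (\<forall>\<F>. finite \<F> \<and> \<F> \<subseteq> \<U> \<longrightarrow> \<Inter>\<F> \<noteq> {}) \<and> (\<forall>A. A \<in> \<U> \<or> - A \<in> \<U>)"
proof -
  define \<A> where "\<A> = {\<U>. \<B> \<subseteq> \<U> \<and> (\<forall>\<F>. finite \<F> \<and> \<F> \<subseteq> \<U> \<longrightarrow> \<Inter>\<F> \<noteq> {})}"
  have "\<exists>\<U>\<in>\<A>. \<forall>\<V>\<in>\<A>. \<U> \<subseteq> \<V> \<longrightarrow> \<V> = \<U>"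
  proof (rule subset_Zorn_nonempty)
    show "\<A> \<noteq> {}" using fip by (auto simp: \<A>_def)
  next
    fix \<C> assume \<C>: "\<C> \<noteq> {}" "subset.chain \<A> \<C>"
    have "\<Inter>\<F> \<noteq> {}" if \<F>: "finite \<F>" "\<F> \<subseteq> \<Union>\<C>" for \<F>
    proof -
      obtain \<U> where "\<U> \<in> \<C>" "\<F> \<subseteq> \<U>"
        using finite_subset_Union_chain[OF \<F> \<C>] .
      moreover from this have "\<U> \<in> \<A>" using \<C>(2) by (simp add: subset_chain_def subset_iff)
      ultimately show ?thesis using \<F>(1) unfolding \<A>_def by blast
    qed
    moreover obtain \<U> where "\<U> \<in> \<C>" "\<U> \<in> \<A>"
      using \<C> by (metis ex_in_conv subsetD subset_chain_def)
    then have "\<B> \<subseteq> \<Union>\<C>" by (auto simp: \<A>_def)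
    ultimately show "\<Union>\<C> \<in> \<A>" by (simp add: \<A>_def)
  qed
  then obtain \<U> where \<U>: "\<U> \<in> \<A>" and max: "\<And>\<V>. \<V> \<in> \<A> \<Longrightarrow> \<U> \<subseteq> \<V> \<Longrightarrow> \<V> = \<U>" by blast
  have fip\<U>: "\<Inter>\<F> \<noteq> {}" if "finite \<F>" "\<F> \<subseteq> \<U>" for \<F> using \<U> that by (auto simp: \<A>_def)
  \<comment> \<open>By maximality, adding a set outside \<open>\<U>\<close> destroys the finite
    intersection property. If \<open>A\<close> and its complement were both outside, their two
    finite witnesses together would have empty intersection.\<close>
  have *: "\<exists>\<F>. finite \<F> \<and> \<F> \<subseteq> \<U> \<and> A \<inter> \<Inter>\<F> = {}" if "A \<notin> \<U>" for A
  proof -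
    have "insert A \<U> \<notin> \<A>" using max[of "insert A \<U>"] that by blast
    then obtain \<F> where \<F>: "finite \<F>" "\<F> \<subseteq> insert A \<U>" "\<Inter>\<F> = {}"
      using \<U> by (auto simp: \<A>_def)
    then have "finite (\<F> - {A})" "\<F> - {A} \<subseteq> \<U>" "A \<inter> \<Inter>(\<F> - {A}) = {}" by auto
    then show ?thesis by blast
  qed
  have "A \<in> \<U> \<or> - A \<in> \<U>" for A
  proof (rule ccontr)
    assume "\<not> ?thesis"
    then have A: "A \<notin> \<U>" "- A \<notin> \<U>" by simp_all
    obtain \<F> where \<F>: "finite \<F>" "\<F> \<subseteq> \<U>" "A \<inter> \<Inter>\<F> = {}"
      using *[OF A(1)] by auto
    obtain \<G> where \<G>: "finite \<G>" "\<G> \<subseteq> \<U>" "- A \<inter> \<Inter>\<G> = {}"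
      using *[OF A(2)] by auto
    have "\<Inter>(\<F> \<union> \<G>) \<noteq> {}"
      using \<F> \<G> by (intro fip\<U>) simp_all
    moreover have "\<Inter>(\<F> \<union> \<G>) \<subseteq> (A \<inter> \<Inter>\<F>) \<union> (- A \<inter> \<Inter>\<G>)" by auto
    ultimately show False unfolding \<F>(3) \<G>(3) by simp
  qed
  moreover have "\<B> \<subseteq> \<U>" using \<U> by (simp add: \<A>_def)
  ultimately show ?thesis using fip\<U> by (intro exI[of _ \<U>]) simp
qed

lemma ends_accumulate_at_unbounded:
  assumes X: "locally_compact_space X" "Hausdorff_space X"
    and C: "C \<subseteq> topspace X" "\<not> compactin X (X closure_of C)"
  shows "\<exists>e\<in>ends X. e \<in> Freudenthal X derived_set_of (Freudenthal_embed X ` C)"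
proof -
  \<comment> \<open>Compact sets are closed here, so a compact superset of \<open>C\<close> would
    make the closure of \<open>C\<close> compact. As finite unions of compact sets are compact, the
    sets \<open>C - K\<close> have the finite intersection property.\<close>
  have unb: "\<not> C \<subseteq> K" if "compactin X K" for K
    using C(2) closed_compactin[OF that] closure_of_minimal[of C K X]
      compactin_imp_closedin[OF X(2) that] by auto
  have "\<Inter>\<F> \<noteq> {}" if \<F>: "finite \<F>" "\<F> \<subseteq> (\<lambda>K. C - K) ` Collect (compactin X)" for \<F>
  proof -
    obtain \<K> where \<K>: "\<K> \<subseteq> Collect (compactin X)" "finite \<K>" "\<F> = (\<lambda>K. C - K) ` \<K>"
      using finite_subset_image[OF \<F>] by blast
    then have "compactin X (\<Union>\<K>)" by (intro compactin_Union) auto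
    then obtain x where "x \<in> C" "x \<notin> \<Union>\<K>" using unb by blast
    then have "x \<in> \<Inter>\<F>" by (auto simp: \<K>(3))
    then show ?thesis by blast
  qed
  then have "\<forall>\<F>. finite \<F> \<and> \<F> \<subseteq> (\<lambda>K. C - K) ` Collect (compactin X) \<longrightarrow> \<Inter>\<F> \<noteq> {}"
    by simp
  from ultrafilter_extension[OF this] obtain \<U>
    where base: "(\<lambda>K. C - K) ` Collect (compactin X) \<subseteq> \<U>"
    and fip': "\<forall>\<F>. finite \<F> \<and> \<F> \<subseteq> \<U> \<longrightarrow> \<Inter>\<F> \<noteq> {}"
    and ult: "\<forall>A. A \<in> \<U> \<or> - A \<in> \<U>"
    by (elim exE conjE)
  have fip: "\<Inter>\<F> \<noteq> {}" if "finite \<F>" "\<F> \<subseteq> \<U>" for \<F>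
    using fip' that by simp
  have "\<forall>k\<in>end_collections X. \<exists>c. (\<exists>U\<in>snd k. c = X closure_of U) \<and> c \<in> \<U>"
  proof (rule ballI, rule ccontr)
    fix k assume k: "k \<in> end_collections X"
      and "\<not> (\<exists>c. (\<exists>U\<in>snd k. c = X closure_of U) \<and> c \<in> \<U>)"
    then have no: "- (X closure_of U) \<in> \<U>" if "U \<in> snd k" for U
      using ult that by blast
    obtain K where K: "compactin X K" "fst k \<subseteq> K"
      using end_collectionsD(3)[OF k] by (auto simp: bounded_in_def)
    then have "C - K \<in> \<U>" using base by blast
    with no have "\<Inter>(insert (C - K) ((\<lambda>U. - (X closure_of U)) ` snd k)) \<noteq> {}"
      using end_collectionsD(1)[OF k] by (intro fip) auto
    then obtain x where "x \<in> C" "x \<notin> K" "\<And>U. U \<in> snd k \<Longrightarrow> x \<notin> X closure_of U" by auto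
    then show False
      using C(1) K(2) end_collectionsD(5)[OF k] by blast
  qed
  then obtain f where f: "\<And>k. k \<in> end_collections X \<Longrightarrow> (\<exists>U\<in>snd k. f k = X closure_of U) \<and> f k \<in> \<U>"
    by metis
  define t where "t = restrict f (end_collections X)"
  have tU: "\<exists>U\<in>snd k. t k = X closure_of U" "t k \<in> \<U>" "t k \<in> cells X k" if "k \<in> end_collections X" for k
    using f[OF that] that by (auto simp: t_def cells_def)
  have "t l \<subseteq> t k" if kl: "k \<in> end_collections X" "l \<in> end_collections X" "end_le X k l" for k l
  proof -
    obtain d where d: "d \<in> cells X k" "t l \<subseteq> d"
      using kl(3) tU(3)[OF kl(2)] unfolding end_le_def refines_def by blast
    \<comment> \<open>Both cells belong to the ultrafilter, so they meet. The cell \<open>d\<close>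
      of \<open>k\<close> containing \<open>t l\<close> therefore meets \<open>t k\<close>, and
      distinct cells are disjoint.\<close>
    have "\<Inter>{t k, t l} \<noteq> {}" using tU(2) kl by (intro fip) auto
    then have "d \<inter> t k \<noteq> {}" using d(2) by auto
    then have "d = t k"
      using disjointD[OF partition_onD2[OF partition_on_cells[OF kl(1)]] d(1) tU(3)[OF kl(1)]] by blast
    then show ?thesis using d by simp
  qed
  then have t: "t \<in> topspace (Freudenthal X)"
    unfolding topspace_Freudenthal using tU(3) by (auto simp: t_def)
  have tne: "Freudenthal_embed X x \<noteq> t" if x: "x \<in> topspace X" for x
  proof
    assume eq: "Freudenthal_embed X x = t"
    have "compactin X {x}" using x by simp
    then obtain k where k: "k \<in> end_collections X" "{x} \<subseteq> fst k"
      using compact_subset_end_collection[OF X] by metis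
    then have "{x} \<in> cells X k" by (simp add: cells_def)
    then have "t k = {x}" using Freudenthal_embed_eq[OF k(1)] eq by auto
    then show False using tU(1)[OF k(1)] end_collectionsD(8)[OF k(1)] k(2) by blast
  qed
  have "\<exists>y\<noteq>t. y \<in> Freudenthal_embed X ` C \<and> y \<in> T" if T: "t \<in> T" "openin (Freudenthal X) T" for T
  proof -
    let ?I = "end_collections X" and ?P = "\<lambda>k. partition_topology X (cells X k)"
    obtain S Q where S: "openin (product_topology ?P ?I) S" "T = S \<inter> Q"
        "topspace (Freudenthal X) = topspace (product_topology ?P ?I) \<inter> Q"
      using T(2) unfolding Freudenthal_def openin_subtopology topspace_subtopology by blast
    then obtain U where U: "finite {i \<in> ?I. U i \<noteq> topspace (?P i)}" "t \<in> Pi\<^sub>E ?I U" "Pi\<^sub>E ?I U \<subseteq> S"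
      using T(1) by (auto simp: openin_product_topology_alt)
    \<comment> \<open>Only the finitely many coordinates in \<open>J\<close> are restricted. A point
      of \<open>C\<close> common to the cells \<open>t i\<close> with \<open>i \<in> J\<close> has
      the same coordinates there as \<open>t\<close>.\<close>
    define J where "J = {i \<in> ?I. U i \<noteq> topspace (?P i)}"
    \<comment> \<open>The empty compact set puts \<open>C\<close> itself into the
      ultrafilter.\<close>
    have "C - {} \<in> \<U>" using base compactin_empty by blast
    then have "\<Inter>(insert C (t ` J)) \<noteq> {}"
      using U(1) tU(2) by (intro fip) (auto simp: J_def)
    then obtain x where x: "x \<in> C" "\<And>i. i \<in> J \<Longrightarrow> x \<in> t i" by auto
    have xX: "x \<in> topspace X" using x(1) C(1) by blast
    note et = Freudenthal_embed_in_topspace[OF xX]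
    have "Freudenthal_embed X x i \<in> U i" if i: "i \<in> ?I" for i
    proof (cases "i \<in> J")
      case True
      then show ?thesis
        using Freudenthal_embed_eq[OF i tU(3)[OF i]] x(2) PiE_mem[OF U(2) i] by simp
    next
      case False
      then have "U i = cells X i"
        using i topspace_partition_topology[OF partition_on_cells[OF i]] by (simp add: J_def)
      then show ?thesis using Freudenthal_cell(1)[OF et i] by simp
    qed
    then have "Freudenthal_embed X x \<in> Pi\<^sub>E ?I U"
      by (simp add: PiE_iff Freudenthal_embed_def)
    then have "Freudenthal_embed X x \<in> T" using U(3) S(2,3) et by auto
    then show ?thesis using x(1) tne[OF xX] by blast
  qed
  then have "t \<in> Freudenthal X derived_set_of (Freudenthal_embed X ` C)"
    using t by (simp add: in_derived_set_of)
  moreover have "t \<in> ends X" using t tne by (auto simp: ends_def)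
  ultimately show ?thesis by blast
qed

lemma long_ends_imp_omega_bounded:
  assumes X: "locally_compact_space X" "Hausdorff_space X"
    and long: "\<And>e. e \<in> ends X \<Longrightarrow> long_end X e"
  shows "omega_bounded X"
  unfolding omega_bounded_def
proof (intro allI impI, rule ccontr)
  fix C assume C: "C \<subseteq> topspace X \<and> countable C" "\<not> compactin X (X closure_of C)"
  then obtain e where e: "e \<in> ends X" "e \<in> Freudenthal X derived_set_of (Freudenthal_embed X ` C)"
    using ends_accumulate_at_unbounded[OF X] by blast
  have "Freudenthal_embed X ` C \<subseteq> topspace (Freudenthal X)"
    using C(1) by (auto intro: Freudenthal_embed_in_topspace)
  then have "e \<notin> Freudenthal X derived_set_of (Freudenthal_embed X ` C)"
    using long[OF e(1)] C(1) by (simp add: long_end_def weak_P_point_def)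
  then show False using e(2) by contradiction
qed

section \<open>Ends of omega-bounded spaces\<close>

text \<open>Each pair of distinct ends differs at some index. An upper bound of these finitely many
  indices separates all pairs, because cells shrink along the order and distinct cells are
  disjoint.\<close>

lemma ends_separated:
  assumes X: "locally_compact_space X" "Hausdorff_space X"
    and A: "finite A" "A \<subseteq> ends X"
  shows "\<exists>k\<in>end_collections X. inj_on (\<lambda>e. e k) A"
proof -
  \<comment> \<open>A default index: it serves the pairs with \<open>a = b\<close> and keeps
    \<open>S\<close> nonempty when \<open>A\<close> is empty.\<close>
  obtain k0 where k0: "k0 \<in> end_collections X"
    using compact_subset_end_collection[OF X compactin_empty] by metis
  have At: "a \<in> topspace (Freudenthal X)" if "a \<in> A" for a
    using that A(2) by (auto simp: ends_def)
  have "\<exists>k\<in>end_collections X. a \<noteq> b \<longrightarrow> a k \<noteq> b k" if "a \<in> A" "b \<in> A" for a b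
    using Freudenthal_eqI[OF At[OF that(1)] At[OF that(2)]] k0 by blast
  then obtain \<kappa> where \<kappa>: "\<And>a b. a \<in> A \<Longrightarrow> b \<in> A \<Longrightarrow> \<kappa> a b \<in> end_collections X"
      "\<And>a b. a \<in> A \<Longrightarrow> b \<in> A \<Longrightarrow> a \<noteq> b \<Longrightarrow> a (\<kappa> a b) \<noteq> b (\<kappa> a b)"
    by metis
  define S where "S = insert k0 ((\<lambda>(a, b). \<kappa> a b) ` (A \<times> A))"
  have "finite S" "S \<noteq> {}" "S \<subseteq> end_collections X"
    using A(1) k0 \<kappa>(1) by (auto simp: S_def)
  then obtain m where m: "m \<in> end_collections X" "\<forall>k\<in>S. end_le X k m"
    using end_collections_upper_bound by metis
  have "inj_on (\<lambda>e. e m) A"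
  proof (rule inj_onI, rule ccontr)
    fix a b assume ab: "a \<in> A" "b \<in> A" "a m = b m" "a \<noteq> b"
    let ?k = "\<kappa> a b"
    have k: "?k \<in> end_collections X" "end_le X ?k m"
      using \<kappa>(1) ab m(2) by (auto simp: S_def)
    have "a m \<subseteq> a ?k" "a m \<subseteq> b ?k" "a m \<noteq> {}"
      using Freudenthal_mono[OF At[OF ab(1)] k(1) m(1) k(2)] Freudenthal_mono[OF At[OF ab(2)] k(1) m(1) k(2)]
        ab(3) Freudenthal_cell(2)[OF At[OF ab(1)] m(1)] by auto
    then have "a ?k \<inter> b ?k \<noteq> {}" by blast
    then have "a ?k = b ?k"
      using disjointD[OF partition_onD2[OF partition_on_cells[OF k(1)]]
          Freudenthal_cell(1)[OF At[OF ab(1)] k(1)] Freudenthal_cell(1)[OF At[OF ab(2)] k(1)]] by blast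
    then show False using \<kappa>(2)[OF ab(1,2,4)] by contradiction
  qed
  with m(1) show ?thesis by blast
qed

text \<open>Otherwise \<open>U - G\<close> would be clopen: it equals
  \<open>X closure_of U - G\<close> because the boundary of \<open>U\<close> lies in
  \<open>G\<close>, and \<open>U - X closure_of G\<close> because \<open>U\<close> misses the
  boundary of \<open>G\<close>.\<close>

lemma unbounded_meets_boundary:
  assumes X: "connected_space X" and U: "openin X U" "X closure_of U - U \<subseteq> G" "\<not> X closure_of U \<subseteq> G"
    and G: "openin X G" "G \<noteq> {}"
  shows "U \<inter> (X closure_of G - G) \<noteq> {}"
proof
  assume *: "U \<inter> (X closure_of G - G) = {}"
  have Ucl: "U \<subseteq> X closure_of U" by (simp add: U(1) closure_of_subset openin_subset)
  have Gcl: "G \<subseteq> X closure_of G" by (simp add: G(1) closure_of_subset openin_subset)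
  define E where "E = U - G"
  have E: "E = X closure_of U - G" using U(2) Ucl by (auto simp: E_def)
  have "E = U - X closure_of G" using * Gcl by (auto simp: E_def)
  then have "openin X E" using U(1) by (simp add: openin_diff)
  moreover have "closedin X E" unfolding E using G(1) by (simp add: closedin_diff)
  ultimately have "E = {} \<or> E = topspace X" using X by (simp add: connected_space_clopen_in)
  moreover have "E \<noteq> {}" using E U(3) by auto
  moreover have "E \<noteq> topspace X" using G openin_subset[OF G(1)] by (auto simp: E_def)
  ultimately show False by blast
qed

text \<open>Off the boundary, \<open>U\<close> and the complement of its closure are disjoint open
  sets covering \<open>D\<close>.\<close>

lemma connectedin_avoiding_boundary:
  assumes "connectedin X D" "openin X U" "D \<inter> (X closure_of U - U) = {}" "D \<inter> U \<noteq> {}"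
  shows "D \<subseteq> U"
proof -
  have D: "D \<subseteq> topspace X" using assms(1) by (rule connectedin_subset_topspace)
  have Ucl: "U \<subseteq> X closure_of U" by (simp add: assms(2) closure_of_subset openin_subset)
  let ?V = "topspace X - X closure_of U"
  have "openin X ?V" by (simp add: openin_diff)
  moreover have "D \<subseteq> U \<union> ?V" "U \<inter> ?V \<inter> D = {}" using D assms(3) Ucl by auto
  ultimately have "?V \<inter> D = {}"
    using assms(1,2,4) unfolding connectedin by (metis Int_commute)
  then show ?thesis using D assms(3) by auto
qed

text \<open>Through \<open>sep\<close>, the boundaries of countably many collections lie in the
  closure of a single countable set. This makes the bound on the number of ends uniform.\<close>

lemma omega_bounded_imp_finite_ends:
  assumes X: "locally_compact_space X" "Hausdorff_space X" "locally_connected_space X" "connected_space X"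
    and sep: "\<And>K. compactin X K \<Longrightarrow> \<exists>C. countable C \<and> C \<subseteq> topspace X \<and> K \<subseteq> X closure_of C"
    and om: "omega_bounded X"
  shows "finite (ends X)"
proof (rule ccontr)
  assume "infinite (ends X)"
  then obtain e :: "nat \<Rightarrow> _" where e: "inj e" "range e \<subseteq> ends X"
    using infinite_countable_subset by blast
  \<comment> \<open>In the abstraction the bound \<open>e\<close> is a single end and shadows the
    sequence \<open>e\<close>.\<close>
  have "\<exists>k\<in>end_collections X. inj_on (\<lambda>e. e k) (e ` {..<N})" for N
    using e(2) by (intro ends_separated X) auto
  then obtain \<kappa> where \<kappa>: "\<And>N. \<kappa> N \<in> end_collections X" "\<And>N. inj_on (\<lambda>e. e (\<kappa> N)) (e ` {..<N})"
    by metis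
  define bd where "bd N = (\<Union>U\<in>snd (\<kappa> N). X closure_of U - U)" for N
  have "compactin X (bd N)" for N
    unfolding bd_def using end_collectionsD(1,7)[OF \<kappa>(1)] by (intro compactin_Union) auto
  then have "\<exists>C. countable C \<and> C \<subseteq> topspace X \<and> bd N \<subseteq> X closure_of C" for N by (rule sep)
  then obtain C where C: "\<And>N. countable (C N)" "\<And>N. C N \<subseteq> topspace X" "\<And>N. bd N \<subseteq> X closure_of (C N)"
    by metis
  have e0: "e 0 \<in> topspace (Freudenthal X)" using e(2) by (auto simp: ends_def)
  have "e 0 (\<kappa> 0) \<noteq> {}" "e 0 (\<kappa> 0) \<subseteq> topspace X"
    using Freudenthal_cell[OF e0 \<kappa>(1)[of 0]] partition_onD1[OF partition_on_cells[OF \<kappa>(1)[of 0]]]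
    by (auto intro: Union_upper)
  then obtain x0 where x0: "x0 \<in> topspace X" by blast
  \<comment> \<open>The point \<open>x0\<close> makes \<open>K\<close>, and hence \<open>G\<close>,
    nonempty, as \<open>unbounded_meets_boundary\<close> requires.\<close>
  define S where "S = insert x0 (\<Union>N. C N)"
  have S: "S \<subseteq> topspace X" "countable S" using C x0 by (auto simp: S_def)
  define K where "K = X closure_of S"
  have K: "compactin X K" using om S by (simp add: omega_bounded_def K_def)
  have bdK: "bd N \<subseteq> K" for N
  proof -
    have "X closure_of (C N) \<subseteq> K" unfolding K_def by (rule closure_of_mono) (auto simp: S_def)
    then show ?thesis using C(3) by blast
  qed
  have x0K: "x0 \<in> K" using closure_of_subset[OF S(1)] by (auto simp: K_def S_def)
  obtain k where k: "k \<in> end_collections X" "K \<subseteq> fst k" "compactin X (X closure_of (fst k))"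
    "compactin X (X closure_of (fst k) - fst k)"
    by (rule compact_subset_end_collection[OF X(1,2) K])
  define G where "G = fst k"
  have G: "openin X G" "K \<subseteq> G" "compactin X (X closure_of G)" "compactin X (X closure_of G - G)"
    using k end_collectionsD(4)[OF k(1)] by (simp_all add: G_def)
  have "\<exists>D. openin X D \<and> connectedin X D \<and> D \<inter> K = {} \<and> b \<in> D" if "b \<in> X closure_of G - G" for b
  proof -
    have "openin X (topspace X - K)" by (simp add: K_def openin_diff)
    moreover have "b \<in> topspace X - K" using that G(2) closure_of_subset_topspace[of X G] by auto
    moreover have "neighbourhood_base_of (\<lambda>U. openin X U \<and> connectedin X U) X"
      using X(3) by (simp add: locally_connected_space_alt)
    ultimately obtain P Q where "openin X P" "openin X Q" "connectedin X Q" "b \<in> P" "P \<subseteq> Q" "Q \<subseteq> topspace X - K"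
      unfolding neighbourhood_base_of by metis
    then show ?thesis by (intro exI[of _ Q]) auto
  qed
  then have "X closure_of G - G \<subseteq> \<Union>{D. openin X D \<and> connectedin X D \<and> D \<inter> K = {}}" by blast
  then obtain \<D> where \<D>: "finite \<D>" "\<D> \<subseteq> {D. openin X D \<and> connectedin X D \<and> D \<inter> K = {}}"
      "X closure_of G - G \<subseteq> \<Union>\<D>"
    using compactinD[OF G(4)] by (metis (no_types, lifting) mem_Collect_eq)
  \<comment> \<open>The cover \<open>\<D>\<close> was built from \<open>K\<close>, which contains
    the boundaries for every \<open>N\<close>. So \<open>N\<close> can be fixed only now, as one
    more than the number of connected sets.\<close>
  define N where "N = Suc (card \<D>)"
  note EC = end_collectionsD[OF \<kappa>(1)[of N]]
  have "\<exists>D U. D \<in> \<D> \<and> U \<in> snd (\<kappa> N) \<and> e i (\<kappa> N) = X closure_of U \<and> D \<subseteq> U \<and> D \<noteq> {}" for i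
  proof -
    have ei: "e i \<in> ends X" using e(2) by auto
    obtain U where U: "U \<in> snd (\<kappa> N)" "e i (\<kappa> N) = X closure_of U"
      using ends_cell[OF ei \<kappa>(1)] by blast
    have bdU: "X closure_of U - U \<subseteq> K" using U(1) bdK[of N] by (auto simp: bd_def)
    have "G \<subseteq> X closure_of G" by (simp add: G(1) closure_of_subset openin_subset)
    \<comment> \<open>\<open>G\<close> has compact closure, while the cell of an end is
      unbounded.\<close>
    then have "\<not> X closure_of U \<subseteq> G"
      using ends_cell_unbounded[OF X(1,2) ei \<kappa>(1)[of N]] U(2) G(3)
      unfolding bounded_in_def by (metis order_trans)
    then have "U \<inter> (X closure_of G - G) \<noteq> {}"
      using bdU G(2) x0K by (intro unbounded_meets_boundary[OF X(4) EC(6)[OF U(1)] _ _ G(1)]) auto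
    then obtain b D where b: "b \<in> U" "b \<in> D" "D \<in> \<D>" using \<D>(3) by blast
    have "D \<subseteq> U"
      by (rule connectedin_avoiding_boundary[OF _ EC(6)[OF U(1)]])
        (use \<D>(2) b bdU in auto)
    then show ?thesis using U b by blast
  qed
  then obtain d u where du: "\<And>i. d i \<in> \<D>" "\<And>i. u i \<in> snd (\<kappa> N)" "\<And>i. e i (\<kappa> N) = X closure_of (u i)"
      "\<And>i. d i \<subseteq> u i" "\<And>i. d i \<noteq> {}"
    by metis
  have "inj_on d {..<N}"
  proof (rule inj_onI)
    fix i j assume ij: "i \<in> {..<N}" "j \<in> {..<N}" "d i = d j"
    have cl: "u i \<subseteq> X closure_of (u i)" for i
      by (simp add: EC(6)[OF du(2)] closure_of_subset openin_subset)
    have "d i \<subseteq> X closure_of (u i) \<inter> X closure_of (u j)"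
      using du(4)[of i] du(4)[of j] cl[of i] cl[of j] ij(3) by auto
    then have "u i = u j" using EC(9)[OF du(2) du(2), of i j] du(5)[of i] by blast
    then have "e i (\<kappa> N) = e j (\<kappa> N)" by (simp add: du(3))
    then have "e i = e j" using \<kappa>(2)[of N] ij by (auto simp: inj_on_def)
    then show "i = j" using e(1) by (simp add: inj_eq)
  qed
  then have "card {..<N} \<le> card \<D>"
    using \<D>(1) du(1) by (intro card_inj_on_le) auto
  then show False by (simp add: N_def)
qed

text \<open>A single coordinate separates \<open>e\<close> from \<open>C\<close>: at an index whose
  bounded part contains the closure of \<open>C\<close>, points of \<open>C\<close> have singleton
  cells and \<open>e\<close> has a cell missing that closure.\<close>

lemma omega_bounded_imp_not_accumulation:
  assumes X: "locally_compact_space X" "Hausdorff_space X" and om: "omega_bounded X"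
    and e: "e \<in> ends X" and C: "C \<subseteq> topspace X" "countable C"
  shows "e \<notin> Freudenthal X derived_set_of (Freudenthal_embed X ` C)"
proof
  assume acc: "e \<in> Freudenthal X derived_set_of (Freudenthal_embed X ` C)"
  define K where "K = X closure_of C"
  have K: "compactin X K" using om C by (simp add: omega_bounded_def K_def)
  have CK: "C \<subseteq> K" using C(1) by (simp add: K_def closure_of_subset)
  obtain k where k: "k \<in> end_collections X" "K \<subseteq> fst k"
    using compact_subset_end_collection[OF X K] by metis
  note P = partition_on_cells[OF k(1)]
  \<comment> \<open>Every cell missing \<open>K\<close> is taken. A singleton lies in
    \<open>K\<close> or misses it, and the other cells miss it, so the union is the complement of
    \<open>K\<close> and \<open>\<V>\<close> is open in the quotient.\<close>
  define \<V> where "\<V> = {c \<in> cells X k. c \<inter> K = {}}"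
  have clK: "X closure_of U \<inter> K = {}" if "U \<in> snd k" for U
    using end_collectionsD(8)[OF k(1) that] k(2) by blast
  have "\<Union>\<V> = topspace X - K"
  proof
    show "\<Union>\<V> \<subseteq> topspace X - K" using partition_onD1[OF P] by (auto simp: \<V>_def)
    show "topspace X - K \<subseteq> \<Union>\<V>"
    proof
      fix x assume x: "x \<in> topspace X - K"
      then obtain c where c: "c \<in> cells X k" "x \<in> c" using partition_onD1[OF P] by auto
      then have "c \<inter> K = {}" using x clK by (auto simp: cells_def)
      then show "x \<in> \<Union>\<V>" using c by (auto simp: \<V>_def)
    qed
  qed
  then have "openin (partition_topology X (cells X k)) \<V>"
    by (auto simp: openin_partition_topology[OF P] \<V>_def K_def openin_diff)
  moreover have "continuous_map (Freudenthal X) (partition_topology X (cells X k)) (\<lambda>t. t k)"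
    unfolding Freudenthal_def
    by (intro continuous_map_from_subtopology continuous_map_product_projection k(1))
  ultimately have T: "openin (Freudenthal X) {t \<in> topspace (Freudenthal X). t k \<in> \<V>}"
    by (rule openin_continuous_map_preimage[rotated])
  obtain U where U: "U \<in> snd k" "e k = X closure_of U" using ends_cell[OF e k(1)] by blast
  then have "e k \<in> \<V>" using clK by (auto simp: \<V>_def cells_def)
  then have eT: "e \<in> {t \<in> topspace (Freudenthal X). t k \<in> \<V>}" using e by (simp add: ends_def)
  obtain y where y: "y \<in> Freudenthal_embed X ` C" "y \<in> {t \<in> topspace (Freudenthal X). t k \<in> \<V>}"
    using acc T eT by (metis (no_types, lifting) in_derived_set_of)
  then obtain x where x: "x \<in> C" "Freudenthal_embed X x k \<in> \<V>" by auto
  have "{x} \<in> cells X k" using x(1) CK k(2) by (auto simp: cells_def)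
  then have "Freudenthal_embed X x k = {x}" by (rule Freudenthal_embed_eq[OF k(1)]) simp
  then show False using x CK by (auto simp: \<V>_def)
qed

lemma omega_bounded_imp_long_end:
  assumes X: "locally_compact_space X" "Hausdorff_space X" and om: "omega_bounded X"
    and fin: "finite (ends X)" and e: "e \<in> ends X"
  shows "long_end X e"
proof -
  let ?F = "Freudenthal X"
  have "e \<notin> ?F derived_set_of C" if C: "C \<subseteq> topspace ?F" "countable C" for C
  proof -
    let ?emb = "Freudenthal_embed X ` topspace X"
    have "countable (C \<inter> ?emb)" using C(2) by blast
    then obtain C' where C': "countable C'" "C' \<subseteq> topspace X" "C \<inter> ?emb = Freudenthal_embed X ` C'"
      by (metis countable_subset_image inf_le2)
    \<comment> \<open>The part of \<open>C\<close> in the space is handled by omega-boundedness; the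
      finite set of ends has no accumulation points.\<close>
    have "C \<subseteq> Freudenthal_embed X ` C' \<union> ends X"
      unfolding C'(3)[symmetric] using C(1) by (auto simp: ends_def)
    then have "?F derived_set_of C \<subseteq> ?F derived_set_of (Freudenthal_embed X ` C' \<union> ends X)"
      by (rule derived_set_of_mono)
    also have "\<dots> = ?F derived_set_of (Freudenthal_embed X ` C')"
      using t1_space_Freudenthal[OF X(2)] fin by (simp add: derived_set_of_Un t1_space_derived_set_of_finite)
    finally show ?thesis
      using omega_bounded_imp_not_accumulation[OF X om e C'(2,1)] by blast
  qed
  then show ?thesis
    using e by (auto simp: long_end_def weak_P_point_def ends_def)
qed

section \<open>Manifolds\<close>

text \<open>\<open>Euclidean_space n\<close> is a subspace of the countable power of the real line,
  which has a countable basis.\<close>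

lemma second_countable_Euclidean_space: "second_countable (Euclidean_space n)"
proof -
  obtain \<B> :: "(nat \<Rightarrow> real) set set" where \<B>: "countable \<B>" "topological_basis \<B>"
    using ex_countable_basis by blast
  have "second_countable (euclidean :: (nat \<Rightarrow> real) topology)"
    unfolding second_countable_def
  proof (intro exI conjI ballI allI impI)
    show "countable \<B>" by fact
    show "openin euclidean V" if "V \<in> \<B>" for V
      using topological_basis_open[OF \<B>(2) that] by simp
    show "\<exists>V\<in>\<B>. x \<in> V \<and> V \<subseteq> U" if "openin euclidean U \<and> x \<in> U" for U x
      using topological_basisE[OF \<B>(2), of U x] that by auto
  qed
  then show ?thesis
    by (simp add: Euclidean_space_def euclidean_product_topology second_countable_subtopology)
qed

lemma top_manifold_chart:
  assumes "top_manifold M" "x \<in> topspace M"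
  obtains U n where "openin M U" "x \<in> U" "subtopology M U homeomorphic_space Euclidean_space n"
  using assms unfolding top_manifold_def by metis

lemma top_manifold_locally_compact_space:
  assumes "top_manifold M"
  shows "locally_compact_space M"
  unfolding locally_compact_space_def
proof
  fix x assume x: "x \<in> topspace M"
  obtain U n where U: "openin M U" "x \<in> U" "subtopology M U homeomorphic_space Euclidean_space n"
    using top_manifold_chart[OF assms x] .
  have "locally_compact_space (subtopology M U)"
    using homeomorphic_locally_compact_space[OF U(3)] locally_compact_Euclidean_space by simp
  moreover have "x \<in> topspace (subtopology M U)" using U x by simp
  ultimately obtain V K where "openin (subtopology M U) V" "compactin (subtopology M U) K" "x \<in> V" "V \<subseteq> K"
    unfolding locally_compact_space_def by blast
  then show "\<exists>V K. openin M V \<and> compactin M K \<and> x \<in> V \<and> V \<subseteq> K"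
    unfolding openin_open_subtopology[OF U(1)] compactin_subtopology by blast
qed

lemma top_manifold_locally_connected_space:
  assumes "top_manifold M"
  shows "locally_connected_space M"
  unfolding locally_connected_space_def neighbourhood_base_of
proof (intro allI impI)
  fix W x assume W: "openin M W \<and> x \<in> W"
  then have x: "x \<in> topspace M" using openin_subset by blast
  obtain U n where U: "openin M U" "x \<in> U" "subtopology M U homeomorphic_space Euclidean_space n"
    using top_manifold_chart[OF assms x] .
  have "locally_connected_space (subtopology M U)"
    using homeomorphic_locally_connected_space[OF U(3)] locally_connected_Euclidean_space by simp
  moreover have "openin (subtopology M U) (W \<inter> U)" "x \<in> W \<inter> U"
    using W U by (auto simp: openin_open_subtopology)
  ultimately obtain A B where "openin (subtopology M U) A" "connectedin (subtopology M U) B"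
      "x \<in> A" "A \<subseteq> B" "B \<subseteq> W \<inter> U"
    unfolding locally_connected_space_def neighbourhood_base_of by metis
  then show "\<exists>A B. openin M A \<and> connectedin M B \<and> x \<in> A \<and> A \<subseteq> B \<and> B \<subseteq> W"
    unfolding openin_open_subtopology[OF U(1)] connectedin_subtopology by blast
qed

text \<open>Charts are separable and finitely many cover \<open>K\<close>; the union of their
  countable dense sets serves as \<open>C\<close>, which may leave \<open>K\<close>.\<close>

lemma top_manifold_compactin_subset_closure_of_countable:
  assumes M: "top_manifold M" and K: "compactin M K"
  shows "\<exists>C. countable C \<and> C \<subseteq> topspace M \<and> K \<subseteq> M closure_of C"
proof -
  have chart: "\<exists>U C. openin M U \<and> x \<in> U \<and> countable C \<and> C \<subseteq> topspace M \<and> U \<subseteq> M closure_of C"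
    if x: "x \<in> topspace M" for x
  proof -
    obtain U n where U: "openin M U" "x \<in> U" "subtopology M U homeomorphic_space Euclidean_space n"
      using top_manifold_chart[OF M x] .
    have "separable_space (subtopology M U)"
      using homeomorphic_separable_space[OF U(3)] second_countable_imp_separable_space[OF second_countable_Euclidean_space]
      by simp
    then obtain C where C: "countable C" "C \<subseteq> topspace (subtopology M U)"
        "subtopology M U closure_of C = topspace (subtopology M U)"
      unfolding separable_space_def by blast
    have "U \<subseteq> M closure_of C"
      using closure_of_subtopology_subset[of M U C] C(3) openin_subset[OF U(1)] by auto
    then show ?thesis using U C by auto
  qed
  define \<U> where "\<U> = {U. openin M U \<and> (\<exists>C. countable C \<and> C \<subseteq> topspace M \<and> U \<subseteq> M closure_of C)}"
  have "K \<subseteq> \<Union>\<U>"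
  proof
    fix x assume "x \<in> K"
    then have "x \<in> topspace M" using compactin_subset_topspace[OF K] by blast
    then obtain U C where "openin M U" "x \<in> U" "countable C" "C \<subseteq> topspace M" "U \<subseteq> M closure_of C"
      using chart by metis
    then show "x \<in> \<Union>\<U>" unfolding \<U>_def by (intro UnionI[of U]) auto
  qed
  then obtain \<F> where \<F>: "finite \<F>" "\<F> \<subseteq> \<U>" "K \<subseteq> \<Union>\<F>"
    using compactinD[OF K, of \<U>] by (auto simp: \<U>_def)
  then have "\<forall>U\<in>\<F>. \<exists>C. countable C \<and> C \<subseteq> topspace M \<and> U \<subseteq> M closure_of C"
    by (auto simp: \<U>_def)
  then obtain C where C: "\<And>U. U \<in> \<F> \<Longrightarrow> countable (C U) \<and> C U \<subseteq> topspace M \<and> U \<subseteq> M closure_of (C U)"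
    by metis
  have "\<Union>\<F> \<subseteq> M closure_of (\<Union>U\<in>\<F>. C U)"
  proof (rule Union_least)
    fix U assume U: "U \<in> \<F>"
    have "M closure_of (C U) \<subseteq> M closure_of (\<Union>U\<in>\<F>. C U)"
      by (rule closure_of_mono) (use U in blast)
    then show "U \<subseteq> M closure_of (\<Union>U\<in>\<F>. C U)" using C[OF U] by blast
  qed
  moreover have "countable (\<Union>U\<in>\<F>. C U)"
    using \<F>(1) C by (intro countable_UN) (auto simp: countable_finite)
  moreover have "(\<Union>U\<in>\<F>. C U) \<subseteq> topspace M" using C by (intro UN_least) simp
  ultimately show ?thesis using \<F>(3) by (meson order_trans)
qed

theorem theorem4p2:
  fixes M :: "'a topology"
  assumes "top_manifold M"
  shows "(omega_bounded M \<longleftrightarrow> (\<forall>e \<in> ends M. long_end M e)) \<and>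
         (omega_bounded M \<longrightarrow> finite (ends M))"
proof -
  have M: "locally_compact_space M" "Hausdorff_space M" "locally_connected_space M" "connected_space M"
    using assms top_manifold_locally_compact_space top_manifold_locally_connected_space
    by (auto simp: top_manifold_def)
  \<comment> \<open>Finiteness comes first, since the proof that ends are long relies on it.\<close>
  have fin: "finite (ends M)" if "omega_bounded M"
    by (rule omega_bounded_imp_finite_ends[OF M top_manifold_compactin_subset_closure_of_countable[OF assms] that])
  moreover have "omega_bounded M \<longleftrightarrow> (\<forall>e \<in> ends M. long_end M e)"
    using omega_bounded_imp_long_end[OF M(1,2) _ fin] long_ends_imp_omega_bounded[OF M(1,2)] by blast
  ultimately show ?thesis by blast
qed

end
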